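(* Let $r\ge 1$ and $d\ge 1$ be integers and let $f\in C(I^d)$. Suppose that $\Psi_r(f,n)=o(2^{-nr})$ as $n\to\infty$. Then $\Psi_r(f,n)=0$ for all integers $n\ge 0$, and $f\in\mathcal{P}_{r,d}$ (i.e. $f$ coincides on $I^d$ with an element of $\mathcal{P}_{r,d}$).
   Context: $I^d=[0,1]^d$; $C(I^d)$ is the space of continuous real-valued functions on $I^d$; $e_i$ is the unit vector in the $i$-th coordinate direction of $\mathbb{R}^d$. $\mathcal{P}_{r,d}$ is the set of real polynomials in $d$ variables of degree smaller than $r$ in each variable. For $h\in\mathbb{R}^d$ with $x,x+rh\in I^d$, $\Delta^r_h f(x)=\sum_{k=0}^r(-1)^{r-k}\binom{r}{k}f(x+kh)$. For an integer $n\ge 0$, $$\Psi_r(f,n)=\sup\bigl\{|\Delta^r_{2^{-n}e_i}f(2^{-n}\kappa)| : 1\le i\le d,\ \kappa\in\mathbb{Z}^d,\ 2^{-n}\kappa\in I^d,\ 2^{-n}(\kappa+re_i)\in I^d\bigr\},$$ with the convention that the supremum of the empty set is $0$. *)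

theory Defs
  imports "HOL-Analysis.Analysis" "HOL-Library.Landau_Symbols"
begin

definition unit_cube :: "(real ^ 'd) set" where
  "unit_cube = {x. \<forall>j. 0 \<le> x $ j \<and> x $ j \<le> 1}"

definition coord_polys :: "nat \<Rightarrow> (real ^ 'd \<Rightarrow> real) set" where
  "coord_polys r =
     {p. \<exists>c :: ('d \<Rightarrow> nat) \<Rightarrow> real.
           \<forall>x. p x = (\<Sum>\<alpha> | \<forall>j. \<alpha> j < r. c \<alpha> * (\<Prod>j\<in>UNIV. (x $ j) ^ \<alpha> j))}"

text \<open>This is a total function of \<open>x\<close> and \<open>h\<close>; it agrees with the difference on the cube
  whenever \<open>x\<close> and \<open>x + r h\<close> both lie in the cube, which is then the case for all the
  nodes \<open>x + k h\<close> by convexity.\<close>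

definition fdiff :: "nat \<Rightarrow> real ^ 'd \<Rightarrow> (real ^ 'd \<Rightarrow> real) \<Rightarrow> real ^ 'd \<Rightarrow> real" where
  "fdiff r h f x =
     (\<Sum>k = 0..r. (-1) ^ (r - k) * real (r choose k) * f (x + real k *\<^sub>R h))"

definition dyadic_point :: "nat \<Rightarrow> int ^ 'd \<Rightarrow> real ^ 'd" where
  "dyadic_point n \<kappa> = (1 / 2 ^ n) *\<^sub>R (\<chi> j. real_of_int (\<kappa> $ j))"

definition dyadic_diffs :: "nat \<Rightarrow> (real ^ 'd \<Rightarrow> real) \<Rightarrow> nat \<Rightarrow> real set" where
  "dyadic_diffs r f n =
     {\<bar>fdiff r ((1 / 2 ^ n) *\<^sub>R axis i 1) f (dyadic_point n \<kappa>)\<bar> | i \<kappa>.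
        dyadic_point n \<kappa> \<in> unit_cube \<and>
        dyadic_point n (\<kappa> + axis i (int r)) \<in> unit_cube}"

text \<open>The set of differences is always finite, so the supremum is a genuine one; it is empty
  iff \<open>r > 2 ^ n\<close>, and \<open>Sup {}\<close> is unspecified on the reals.\<close>

definition Psi :: "nat \<Rightarrow> (real ^ 'd \<Rightarrow> real) \<Rightarrow> nat \<Rightarrow> real" where
  "Psi r f n = (if dyadic_diffs r f n = {} then 0 else Sup (dyadic_diffs r f n))"

end

theory Submission
  imports Defs "HOL-Computational_Algebra.Polynomial"
begin

text \<open>Since \<open>fdiff r (2 h) f x\<close> is the binomial combination of the \<open>fdiff r h f (x + j h)\<close>,
  the sequence \<open>2 ^ (n r) * Psi r f n\<close> is increasing; it tends to \<open>0\<close>, so it vanishes.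
  By Newton's forward formula \<open>f\<close> is then, along each grid line, a polynomial of degree below
  \<open>r\<close>, so it equals its Lagrange interpolant at the nodes \<open>a / 2 ^ r\<close> with \<open>a < r\<close>, which belong to
  every sufficiently fine grid. By density this holds in each variable on the whole cube, and
  interpolating in one variable after another gives the polynomial.\<close>

section \<open>Finite differences\<close>

text \<open>Pascal's rule, by shifting the summation index. It supplies the passage from one order
  to the next in \<open>fdiff_Suc\<close>, \<open>fdiff_double\<close> and
  \<open>newton_forward\<close>.\<close>

lemma sum_choose_Suc:
  fixes a :: "nat \<Rightarrow> real"
  shows "(\<Sum>k\<le>Suc m. real (Suc m choose k) * a k) = (\<Sum>k\<le>m. real (m choose k) * (a k + a (Suc k)))"
proof -
  have "(\<Sum>k\<le>m. real (m choose k) * a k) = (\<Sum>k\<le>Suc m. real (m choose k) * a k)"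
    by simp
  also have "\<dots> = a 0 + (\<Sum>k\<le>m. real (m choose Suc k) * a (Suc k))"
    by (subst sum.atMost_Suc_shift) simp
  finally have "(\<Sum>k\<le>m. real (m choose k) * a k) = a 0 + (\<Sum>k\<le>m. real (m choose Suc k) * a (Suc k))" .
  then show ?thesis
    by (subst sum.atMost_Suc_shift) (simp add: algebra_simps sum.distrib)
qed

text \<open>Removing the truncated subtraction from the exponent of the sign gives the sum the shape
  required by \<open>sum_choose_Suc\<close>.\<close>

lemma fdiff_alt:
  "fdiff r h f x = (-1) ^ r * (\<Sum>k\<le>r. real (r choose k) * ((-1) ^ k * f (x + real k *\<^sub>R h)))"
proof -
  have "(-1) ^ (r - k) = (-1) ^ r * ((-1) ^ k :: real)" if "k \<le> r" for k
    using that by (simp add: minus_one_power_iff)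
  then show ?thesis
    unfolding fdiff_def sum_distrib_left atLeast0AtMost
    by (intro sum.cong) (auto simp: mult_ac)
qed

lemma fdiff_0 [simp]: "fdiff 0 h f x = f x"
  by (simp add: fdiff_def)

lemma fdiff_Suc: "fdiff (Suc r) h f x = fdiff r h f (x + h) - fdiff r h f x"
  unfolding fdiff_alt sum_choose_Suc
  by (simp add: algebra_simps sum.distrib sum_subtractf sum_distrib_left sum_negf)

text \<open>With E the shift by h, this is (E^2 - 1)^r = (E + 1)^r (E - 1)^r with the first factor
  expanded binomially. The induction step uses E^2 - 1 = (E - 1) + E (E - 1).\<close>

lemma fdiff_double:
  "fdiff r (2 *\<^sub>R h) f x = (\<Sum>j\<le>r. real (r choose j) * fdiff r h f (x + real j *\<^sub>R h))"
proof (induction r arbitrary: x)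
  case (Suc r)
  have "fdiff r h f (x + 2 *\<^sub>R h + real j *\<^sub>R h) - fdiff r h f (x + real j *\<^sub>R h)
      = fdiff (Suc r) h f (x + real j *\<^sub>R h) + fdiff (Suc r) h f (x + real (Suc j) *\<^sub>R h)" for j
    by (simp add: fdiff_Suc algebra_simps scaleR_2)
  then show ?case
    unfolding sum_choose_Suc
    by (subst fdiff_Suc) (simp only: Suc.IH flip: sum_subtractf right_diff_distrib)
qed simp

text \<open>With E the shift by h, this is the binomial expansion of E^m = (1 + (E - 1))^m.\<close>

lemma newton_forward:
  "f (x + real m *\<^sub>R h) = (\<Sum>k\<le>m. real (m choose k) * fdiff k h f x)"
proof (induction m arbitrary: x)
  case (Suc m)
  have "f (x + real (Suc m) *\<^sub>R h) = f ((x + h) + real m *\<^sub>R h)"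
    by (simp add: algebra_simps)
  also have "\<dots> = (\<Sum>k\<le>m. real (m choose k) * (fdiff k h f x + fdiff (Suc k) h f x))"
    unfolding Suc.IH fdiff_Suc by simp
  finally show ?case
    unfolding sum_choose_Suc .
qed simp

text \<open>Each further difference is the difference of two neighbouring ones of the previous
  order. The bound by N keeps both inside the range where vanishing is known.\<close>

lemma fdiff_eq_0_higher:
  assumes "\<And>m. m + r \<le> N \<Longrightarrow> fdiff r h f (x + real m *\<^sub>R h) = 0" and "m + (r + j) \<le> N"
  shows "fdiff (r + j) h f (x + real m *\<^sub>R h) = 0"
  using assms(2)
proof (induction j arbitrary: m)
  case (Suc j)
  have "x + real m *\<^sub>R h + h = x + real (Suc m) *\<^sub>R h"
    by (simp add: algebra_simps)
  then have "fdiff (r + Suc j) h f (x + real m *\<^sub>R h)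
      = fdiff (r + j) h f (x + real (Suc m) *\<^sub>R h) - fdiff (r + j) h f (x + real m *\<^sub>R h)"
    by (simp only: add_Suc_right fdiff_Suc)
  also have "\<dots> = 0"
    using Suc.IH[of m] Suc.IH[of "Suc m"] Suc.prems by simp
  finally show ?case .
qed (use assms in simp)

text \<open>The witness is z (z - 1) ... (z - k + 1) / k!, the binomial coefficient as a polynomial
  in its upper argument.\<close>

lemma real_choose_poly: "\<exists>p :: real poly. degree p \<le> k \<and> (\<forall>m. poly p (real m) = real (m choose k))"
proof (intro exI conjI allI)
  let ?p = "smult (1 / fact k) (\<Prod>i<k. [:- real i, 1:])"
  have "degree (\<Prod>i<k. [:- real i, 1:]) \<le> (\<Sum>i<k. degree [:- real i, 1:])"
    by (rule degree_prod_sum_le[unfolded o_def]) simp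
  then show "degree ?p \<le> k"
    by simp
  show "poly ?p (real m) = real (m choose k)" for m
    by (simp add: poly_prod binomial_gbinomial gbinomial_prod_rev lessThan_atLeast0)
qed

text \<open>Newton's formula based at x represents all values by the differences at x alone. Those
  of order r and above vanish, so one polynomial serves every m up to N.\<close>

lemma poly_of_fdiff_eq_0:
  assumes "r \<ge> 1" and "\<And>m. m + r \<le> N \<Longrightarrow> fdiff r h f (x + real m *\<^sub>R h) = 0"
  shows "\<exists>p. degree p < r \<and> (\<forall>m\<le>N. f (x + real m *\<^sub>R h) = poly p (real m))"
proof -
  obtain b :: "nat \<Rightarrow> real poly" where
    b: "\<And>k. degree (b k) \<le> k" "\<And>k m. poly (b k) (real m) = real (m choose k)"
    using real_choose_poly by metis
  let ?p = "\<Sum>k<r. smult (fdiff k h f x) (b k)"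
  have "degree (smult (fdiff k h f x) (b k)) \<le> r - 1" if "k < r" for k
    using degree_smult_le[of "fdiff k h f x" "b k"] b(1)[of k] that by linarith
  then have "degree ?p \<le> r - 1"
    by (intro degree_sum_le) auto
  moreover have "f (x + real m *\<^sub>R h) = poly ?p (real m)" if "m \<le> N" for m
  proof -
    have 0: "fdiff k h f x = 0" if "r \<le> k" "k \<le> m" for k
      using fdiff_eq_0_higher[of r N h f x 0 "k - r"] assms(2) that \<open>m \<le> N\<close> by simp
    \<comment> \<open>The range is made independent of m: terms with r \<le> k \<le> m have a
      vanishing difference, those with m < k < r a vanishing binomial coefficient.\<close>
    have "(\<Sum>k\<le>m. real (m choose k) * fdiff k h f x) = (\<Sum>k<r. real (m choose k) * fdiff k h f x)"
    proof (rule sum.mono_neutral_cong)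
      show "real (m choose k) * fdiff k h f x = 0" if "k \<in> {..m} - {..<r}" for k
        using 0 that by simp
      show "real (m choose k) * fdiff k h f x = 0" if "k \<in> {..<r} - {..m}" for k
        using that by simp
    qed auto
    then show ?thesis
      unfolding newton_forward by (simp add: poly_sum b(2) mult.commute)
  qed
  ultimately show ?thesis
    using assms(1) by (intro exI[of _ ?p]) auto
qed

section \<open>Lagrange interpolation\<close>

definition lagrange_basis :: "nat \<Rightarrow> (nat \<Rightarrow> real) \<Rightarrow> nat \<Rightarrow> real poly" where
  "lagrange_basis r t a = (\<Prod>b\<in>{..<r} - {a}. smult (1 / (t a - t b)) [:- t b, 1:])"

lemma degree_lagrange_basis:
  assumes "a < r"
  shows "degree (lagrange_basis r t a) < r"
proof -
  have "degree (lagrange_basis r t a)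
      \<le> (\<Sum>b\<in>{..<r} - {a}. degree (smult (1 / (t a - t b)) [:- t b, 1:]))"
    unfolding lagrange_basis_def by (rule degree_prod_sum_le[unfolded o_def]) simp
  also have "\<dots> \<le> (\<Sum>b\<in>{..<r} - {a}. 1)"
    by (intro sum_mono) simp
  also have "\<dots> < r"
    using assms by simp
  finally show ?thesis .
qed

text \<open>At t a every factor is 1; at another node t c the factor with b = c is 0.\<close>

lemma poly_lagrange_basis:
  assumes "inj_on t {..<r}" and "a < r" and "c < r"
  shows "poly (lagrange_basis r t a) (t c) = (if c = a then 1 else 0)"
proof (cases "c = a")
  case True
  have "poly (smult (1 / (t a - t b)) [:- t b, 1:]) (t a) = 1" if "b \<in> {..<r} - {a}" for b
  proof -
    have "t a - t b \<noteq> 0"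
      using assms(1,2) that by (auto simp: inj_on_def)
    then show ?thesis
      by (simp flip: diff_divide_distrib)
  qed
  then show ?thesis
    using True by (simp add: lagrange_basis_def poly_prod del: poly_smult)
next
  case False
  then show ?thesis
    using assms(3) by (auto simp: lagrange_basis_def poly_prod)
qed

text \<open>Both sides are polynomials in y of degree below r that agree at r distinct nodes, hence
  they coincide.\<close>

lemma lagrange_interpolation:
  assumes "inj_on t {..<r}" and "degree q < r"
  shows "poly q y = (\<Sum>a<r. poly (lagrange_basis r t a) y * poly q (t a))"
proof -
  let ?p = "\<Sum>a<r. smult (poly q (t a)) (lagrange_basis r t a)"
  have "degree (smult (poly q (t a)) (lagrange_basis r t a)) \<le> r - 1" if "a < r" for a
    using degree_smult_le[of "poly q (t a)" "lagrange_basis r t a"]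
      degree_lagrange_basis[OF that, of t] by linarith
  then have "degree ?p \<le> r - 1"
    by (intro degree_sum_le) auto
  then have deg: "degree ?p < r"
    using assms(2) by linarith
  have "poly q z = poly ?p z" if "z \<in> t ` {..<r}" for z
    using that assms(1) by (auto simp: poly_sum poly_lagrange_basis if_distrib cong: if_cong)
  moreover have "card (t ` {..<r}) = r"
    using assms(1) by (simp add: card_image)
  ultimately have "q = ?p"
    using poly_eqI_degree[of "t ` {..<r}" q ?p] assms(2) deg by simp
  then have "poly q y = poly ?p y"
    by simp
  then show ?thesis
    by (simp add: poly_sum mult.commute)
qed

section \<open>Vanishing of the dyadic differences\<close>

lemma unit_cube_eq_cbox: "unit_cube = cbox 0 1"
  by (auto simp: unit_cube_def mem_box_cart)

text \<open>The node is the convex combination of the two end points with weight k / r on the far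
  one; r = 0 is separate because of this quotient.\<close>

lemma fdiff_node_in_cube:
  assumes "x \<in> unit_cube" and "x + real r *\<^sub>R h \<in> unit_cube" and "k \<le> r"
  shows "x + real k *\<^sub>R h \<in> unit_cube"
proof (cases "r = 0")
  case False
  have "convex (unit_cube :: (real ^ 'a) set)"
    unfolding unit_cube_eq_cbox by (rule convex_box)
  then have "(1 - real k / real r) *\<^sub>R x + (real k / real r) *\<^sub>R (x + real r *\<^sub>R h) \<in> unit_cube"
    using assms False by (intro convexD) auto
  moreover have "(1 - real k / real r) *\<^sub>R x + (real k / real r) *\<^sub>R (x + real r *\<^sub>R h) = x + real k *\<^sub>R h"
    using False by (simp add: algebra_simps)
  ultimately show ?thesis
    by simp
qed (use assms in simp)

lemma dyadic_point_add_axis: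
  "dyadic_point n (\<kappa> + axis i (int m)) = dyadic_point n \<kappa> + real m *\<^sub>R ((1 / 2 ^ n) *\<^sub>R axis i 1)"
  by (auto simp: dyadic_point_def vec_eq_iff axis_def field_simps)

text \<open>By compactness f is bounded on the cube, and all nodes of an admissible difference lie
  there. This is what makes \<open>Sup\<close> in \<open>Psi\<close> an upper bound.\<close>

lemma bdd_above_dyadic_diffs:
  assumes "continuous_on unit_cube f"
  shows "bdd_above (dyadic_diffs r f n)"
proof -
  have "compact (f ` unit_cube)"
    by (rule compact_continuous_image[OF assms]) (simp add: unit_cube_eq_cbox)
  then obtain B where B: "\<And>x. x \<in> unit_cube \<Longrightarrow> \<bar>f x\<bar> \<le> B"
    using compact_imp_bounded[of "f ` unit_cube"] by (auto simp: bounded_iff)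
  show ?thesis
  proof (rule bdd_aboveI)
    fix s assume "s \<in> dyadic_diffs r f n"
    then obtain i \<kappa> where s: "s = \<bar>fdiff r ((1 / 2 ^ n) *\<^sub>R axis i 1) f (dyadic_point n \<kappa>)\<bar>"
      and *: "dyadic_point n \<kappa> \<in> unit_cube" "dyadic_point n (\<kappa> + axis i (int r)) \<in> unit_cube"
      unfolding dyadic_diffs_def by blast
    let ?h = "(1 / 2 ^ n) *\<^sub>R axis i 1 :: real ^ 'a"
    have node: "\<bar>f (dyadic_point n \<kappa> + real k *\<^sub>R ?h)\<bar> \<le> B" if "k \<le> r" for k
      using * that B[OF fdiff_node_in_cube] unfolding dyadic_point_add_axis by blast
    have "\<bar>fdiff r ?h f (dyadic_point n \<kappa>)\<bar>
        \<le> (\<Sum>k = 0..r. \<bar>(-1) ^ (r - k) * real (r choose k) * f (dyadic_point n \<kappa> + real k *\<^sub>R ?h)\<bar>)"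
      unfolding fdiff_def by (rule sum_abs)
    also have "\<dots> \<le> (\<Sum>k = 0..r. real (r choose k) * B)"
      by (intro sum_mono) (simp add: abs_mult power_abs mult_left_mono node del: scaleR_scaleR)
    finally show "s \<le> (\<Sum>k = 0..r. real (r choose k) * B)"
      unfolding s .
  qed
qed

lemma Psi_nonneg:
  assumes "continuous_on unit_cube f"
  shows "0 \<le> Psi r f n"
proof (cases "dyadic_diffs r f n = {}")
  case False
  then obtain s where s: "s \<in> dyadic_diffs r f n"
    by blast
  then have "0 \<le> s"
    by (auto simp: dyadic_diffs_def)
  also have "s \<le> Sup (dyadic_diffs r f n)"
    using s by (rule cSup_upper) (rule bdd_above_dyadic_diffs[OF assms])
  finally show ?thesis
    by (simp add: Psi_def)
qed (simp add: Psi_def)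

lemma abs_fdiff_le_Psi:
  assumes "continuous_on unit_cube f"
    and "dyadic_point n \<kappa> \<in> unit_cube" and "dyadic_point n (\<kappa> + axis i (int r)) \<in> unit_cube"
  shows "\<bar>fdiff r ((1 / 2 ^ n) *\<^sub>R axis i 1) f (dyadic_point n \<kappa>)\<bar> \<le> Psi r f n"
proof -
  have "\<bar>fdiff r ((1 / 2 ^ n) *\<^sub>R axis i 1) f (dyadic_point n \<kappa>)\<bar> \<in> dyadic_diffs r f n"
    using assms(2,3) unfolding dyadic_diffs_def by blast
  then show ?thesis
    using cSup_upper[OF _ bdd_above_dyadic_diffs[OF assms(1)]] by (auto simp: Psi_def)
qed

text \<open>By \<open>fdiff_double\<close> a difference on the coarse grid is a combination of
  differences on the next finer grid, with binomial weights of total 2^r.\<close>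

lemma Psi_le_Suc:
  assumes "continuous_on unit_cube f"
  shows "Psi r f n \<le> 2 ^ r * Psi r f (Suc n)"
proof (cases "dyadic_diffs r f n = {}")
  case True
  then show ?thesis
    using Psi_nonneg[OF assms] by (simp add: Psi_def)
next
  case False
  have "Sup (dyadic_diffs r f n) \<le> 2 ^ r * Psi r f (Suc n)"
  proof (rule cSup_least[OF False])
    fix s assume "s \<in> dyadic_diffs r f n"
    then obtain i \<kappa> where s: "s = \<bar>fdiff r ((1 / 2 ^ n) *\<^sub>R axis i 1) f (dyadic_point n \<kappa>)\<bar>"
      and *: "dyadic_point n \<kappa> \<in> unit_cube" "dyadic_point n (\<kappa> + axis i (int r)) \<in> unit_cube"
      unfolding dyadic_diffs_def by blast
    let ?h = "(1 / 2 ^ Suc n) *\<^sub>R axis i 1 :: real ^ 'a"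
    have h: "(1 / 2 ^ n) *\<^sub>R axis i 1 = 2 *\<^sub>R ?h"
      by simp
    \<comment> \<open>Doubling the index names the same point on the finer grid.\<close>
    have x: "dyadic_point n \<kappa> = dyadic_point (Suc n) (\<kappa> + \<kappa>)"
      by (simp add: dyadic_point_def vec_eq_iff)
    \<comment> \<open>The coarse end point is 2 r fine steps away. A fine difference started at
      shift j \<le> r ends at shift j + r \<le> 2 r, so it is admissible.\<close>
    have end_in: "dyadic_point (Suc n) (\<kappa> + \<kappa>) + real (2 * r) *\<^sub>R ?h \<in> unit_cube"
      using *(2) unfolding dyadic_point_add_axis h x by (simp add: mult.commute)
    have node_in: "dyadic_point (Suc n) (\<kappa> + \<kappa> + axis i (int j)) \<in> unit_cube" if "j \<le> 2 * r" for j
      unfolding dyadic_point_add_axis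
      using *(1) end_in that unfolding x by (rule fdiff_node_in_cube)
    have "\<bar>fdiff r ?h f (dyadic_point (Suc n) (\<kappa> + \<kappa>) + real j *\<^sub>R ?h)\<bar> \<le> Psi r f (Suc n)" if "j \<le> r" for j
    proof -
      have eq: "\<kappa> + \<kappa> + axis i (int j) + axis i (int r) = \<kappa> + \<kappa> + axis i (int (j + r))"
        by (simp add: vec_eq_iff axis_def)
      have "dyadic_point (Suc n) (\<kappa> + \<kappa> + axis i (int j) + axis i (int r)) \<in> unit_cube"
        unfolding eq using that by (intro node_in) simp
      with node_in[of j] that show ?thesis
        using abs_fdiff_le_Psi[OF assms, of "Suc n" "\<kappa> + \<kappa> + axis i (int j)" i r]
        unfolding dyadic_point_add_axis by simp
    qed
    then have "(\<Sum>j\<le>r. \<bar>real (r choose j) * fdiff r ?h f (dyadic_point (Suc n) (\<kappa> + \<kappa>) + real j *\<^sub>R ?h)\<bar>)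
        \<le> (\<Sum>j\<le>r. real (r choose j) * Psi r f (Suc n))"
      by (intro sum_mono) (auto simp: abs_mult simp del: power_Suc intro!: mult_left_mono)
    also have "\<dots> = 2 ^ r * Psi r f (Suc n)"
      by (simp add: choose_row_sum flip: sum_distrib_right of_nat_sum)
    finally show "s \<le> 2 ^ r * Psi r f (Suc n)"
      unfolding s h x fdiff_double by (rule order_trans[OF sum_abs])
  qed
  then show ?thesis
    using False by (simp add: Psi_def)
qed

lemma Psi_eq_0:
  assumes "continuous_on unit_cube f" and "(\<lambda>n. Psi r f n) \<in> o(\<lambda>n. 1 / 2 ^ (n * r))"
  shows "Psi r f n = 0"
proof -
  have "incseq (\<lambda>n. 2 ^ (n * r) * Psi r f n)"
  proof (rule incseq_SucI)
    fix n
    show "2 ^ (n * r) * Psi r f n \<le> 2 ^ (Suc n * r) * Psi r f (Suc n)"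
      using mult_left_mono[OF Psi_le_Suc[OF assms(1), of r n], of "2 ^ (n * r)"]
      by (simp add: power_add mult_ac)
  qed
  moreover have "(\<lambda>n. 2 ^ (n * r) * Psi r f n) \<longlonglongrightarrow> 0"
    using smalloD_tendsto[OF assms(2)] by (simp add: mult.commute)
  \<comment> \<open>An increasing sequence stays below its limit, so the asymptotic hypothesis
    controls every level, the coarse ones included.\<close>
  ultimately have "2 ^ (n * r) * Psi r f n \<le> 0"
    by (rule incseq_le)
  then show ?thesis
    using Psi_nonneg[OF assms(1), of r n] by (auto simp: mult_le_0_iff power_le_zero_eq)
qed

section \<open>Interpolation one coordinate at a time\<close>

text \<open>Polymorphic in the entries because it acts on integer grid indices as well as on real
  points.\<close>

definition vec_upd :: "'a ^ 'd \<Rightarrow> 'd \<Rightarrow> 'a \<Rightarrow> 'a ^ 'd" where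
  "vec_upd x i y = (\<chi> j. if j = i then y else x $ j)"

text \<open>Along the grid line through the point in direction i all r-th differences vanish, so f
  is a polynomial of degree below r there. The nodes do not depend on n, which permits a limit
  later; r \<le> n places them on the grid.\<close>

lemma interpolate_dyadic:
  fixes f :: "real ^ 'd \<Rightarrow> real"
  assumes cont: "continuous_on unit_cube f" and "r \<ge> 1" and Psi: "Psi r f n = 0" and "r \<le> n"
    and x: "dyadic_point n \<kappa> \<in> unit_cube"
  shows "f (dyadic_point n \<kappa>) = (\<Sum>a<r. poly (lagrange_basis r (\<lambda>b. real b / 2 ^ r) a) (dyadic_point n \<kappa> $ i)
    * f (vec_upd (dyadic_point n \<kappa>) i (real a / 2 ^ r)))"
proof -
  define t :: "nat \<Rightarrow> real" where "t b = real b / 2 ^ r" for b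
  \<comment> \<open>The point of the grid line on the face where coordinate i is 0; the line is
    reached from it by 0 to 2^n steps.\<close>
  define \<kappa>0 where "\<kappa>0 = vec_upd \<kappa> i 0"
  let ?h = "(1 / 2 ^ n) *\<^sub>R axis i 1 :: real ^ 'd"
  have line: "dyadic_point n \<kappa>0 + real m *\<^sub>R ?h = vec_upd (dyadic_point n \<kappa>) i (real m / 2 ^ n)" for m
    by (simp add: dyadic_point_def \<kappa>0_def vec_upd_def vec_eq_iff axis_def)
  have line_in: "dyadic_point n (\<kappa>0 + axis i (int m)) \<in> unit_cube" if "m \<le> 2 ^ n" for m
  proof -
    have "real m / 2 ^ n \<le> 1"
      using that by simp
    then show ?thesis
      unfolding dyadic_point_add_axis line using x by (auto simp: unit_cube_def vec_upd_def)
  qed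
  have "fdiff r ?h f (dyadic_point n \<kappa>0 + real m *\<^sub>R ?h) = 0" if "m + r \<le> 2 ^ n" for m
  proof -
    have eq: "\<kappa>0 + axis i (int m) + axis i (int r) = \<kappa>0 + axis i (int (m + r))"
      by (simp add: vec_eq_iff axis_def)
    have "dyadic_point n (\<kappa>0 + axis i (int m) + axis i (int r)) \<in> unit_cube"
      unfolding eq using that by (intro line_in)
    with line_in[of m] that show ?thesis
      using abs_fdiff_le_Psi[OF cont, of n "\<kappa>0 + axis i (int m)" i r]
      unfolding dyadic_point_add_axis Psi by simp
  qed
  from poly_of_fdiff_eq_0[OF \<open>r \<ge> 1\<close> this]
  obtain p where p: "degree p < r"
    "\<And>m. m \<le> 2 ^ n \<Longrightarrow> f (dyadic_point n \<kappa>0 + real m *\<^sub>R ?h) = poly p (real m)"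
    by blast
  \<comment> \<open>The polynomial p takes the step number m as its argument; substituting m = 2^n y
    makes it a polynomial in the coordinate y.\<close>
  define q where "q = pcompose p [:0, 2 ^ n:]"
  have "degree q < r"
    using p(1) by (simp add: q_def degree_pcompose)
  moreover have q: "f (vec_upd (dyadic_point n \<kappa>) i (real m / 2 ^ n)) = poly q (real m / 2 ^ n)" if "m \<le> 2 ^ n" for m
    using p(2)[OF that] unfolding line by (simp add: q_def poly_pcompose)
  moreover have "inj_on t {..<r}"
    by (simp add: inj_on_def t_def)
  ultimately have interp: "poly q y = (\<Sum>a<r. poly (lagrange_basis r t a) y * poly q (t a))" for y
    using lagrange_interpolation by blast
  \<comment> \<open>The node a / 2^r is the grid point with step number a * 2^(n - r).\<close>
  have node: "poly q (t a) = f (vec_upd (dyadic_point n \<kappa>) i (t a))" if "a < r" for a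
  proof -
    have "a \<le> 2 ^ r"
      using that less_exp[of r] by linarith
    then have "a * 2 ^ (n - r) \<le> 2 ^ r * 2 ^ (n - r)"
      by (rule mult_right_mono) simp
    also have "\<dots> = 2 ^ n"
      using \<open>r \<le> n\<close> by (simp flip: power_add)
    finally have "a * 2 ^ (n - r) \<le> 2 ^ n" .
    moreover have "real (a * 2 ^ (n - r)) / 2 ^ n = t a"
      using \<open>r \<le> n\<close> by (simp add: t_def field_simps flip: power_add)
    ultimately show ?thesis
      using q by metis
  qed
  have "0 \<le> \<kappa> $ i" and "\<kappa> $ i \<le> 2 ^ n"
    using x by (auto simp: unit_cube_def dyadic_point_def field_simps dest!: spec[of _ i])
  then have \<kappa>: "nat (\<kappa> $ i) \<le> 2 ^ n" "real (nat (\<kappa> $ i)) / 2 ^ n = dyadic_point n \<kappa> $ i"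
    by (auto simp: dyadic_point_def nat_le_iff)
  have "vec_upd (dyadic_point n \<kappa>) i (dyadic_point n \<kappa> $ i) = dyadic_point n \<kappa>"
    by (simp add: vec_upd_def vec_eq_iff)
  then have "f (dyadic_point n \<kappa>) = poly q (dyadic_point n \<kappa> $ i)"
    using q[OF \<kappa>(1)] unfolding \<kappa>(2) by simp
  also have "\<dots> = (\<Sum>a<r. poly (lagrange_basis r t a) (dyadic_point n \<kappa> $ i)
      * f (vec_upd (dyadic_point n \<kappa>) i (t a)))"
    unfolding interp[of "dyadic_point n \<kappa> $ i"] by (intro sum.cong) (auto simp: node)
  finally show ?thesis
    unfolding t_def .
qed

text \<open>Rounding each coordinate down keeps it between 0 and its old value and moves it by at
  most 2^(-n).\<close>

lemma dyadic_approximation: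
  assumes "x \<in> unit_cube"
  defines "\<kappa> \<equiv> \<lambda>n. \<chi> j. \<lfloor>2 ^ n * x $ j\<rfloor>"
  shows "dyadic_point n (\<kappa> n) \<in> unit_cube" and "(\<lambda>n. dyadic_point n (\<kappa> n)) \<longlonglongrightarrow> x"
proof -
  have le: "dyadic_point n (\<kappa> n) $ j \<le> x $ j" for n j
    by (simp add: dyadic_point_def \<kappa>_def field_simps)
  have ge: "x $ j - (1/2) ^ n \<le> dyadic_point n (\<kappa> n) $ j" for n j
  proof -
    have "2 ^ n * x $ j - 1 \<le> \<lfloor>2 ^ n * x $ j\<rfloor>"
      by linarith
    then have "(2 ^ n * x $ j - 1) / 2 ^ n \<le> \<lfloor>2 ^ n * x $ j\<rfloor> / 2 ^ n"
      by (rule divide_right_mono) simp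
    then show ?thesis
      by (simp add: dyadic_point_def \<kappa>_def diff_divide_distrib power_divide)
  qed
  have "0 \<le> dyadic_point n (\<kappa> n) $ j" for j
    using assms(1) by (simp add: unit_cube_def dyadic_point_def \<kappa>_def)
  then show "dyadic_point n (\<kappa> n) \<in> unit_cube"
    using le[of n] assms(1) unfolding unit_cube_def by (auto intro: order_trans)
  show "(\<lambda>n. dyadic_point n (\<kappa> n)) \<longlonglongrightarrow> x"
  proof (rule vec_tendstoI)
    fix j
    have "(\<lambda>n. x $ j - (1/2) ^ n) \<longlonglongrightarrow> x $ j - 0"
      by (intro tendsto_intros LIMSEQ_realpow_zero) auto
    then have lim: "(\<lambda>n. x $ j - (1/2) ^ n) \<longlonglongrightarrow> x $ j"
      by simp
    show "(\<lambda>n. dyadic_point n (\<kappa> n) $ j) \<longlonglongrightarrow> x $ j"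
      by (rule tendsto_sandwich[OF always_eventually always_eventually lim tendsto_const]) (simp_all add: le ge)
  qed
qed

text \<open>Both sides of \<open>interpolate_dyadic\<close> pass to the limit along dyadic points
  tending to x: the sum has r terms for every n, and f is continuous on the cube.\<close>

lemma interpolate_coordinate:
  fixes f :: "real ^ 'd \<Rightarrow> real"
  assumes cont: "continuous_on unit_cube f" and "r \<ge> 1" and Psi: "\<And>n. Psi r f n = 0"
    and x: "x \<in> unit_cube"
  shows "f x = (\<Sum>a<r. poly (lagrange_basis r (\<lambda>b. real b / 2 ^ r) a) (x $ i)
    * f (vec_upd x i (real a / 2 ^ r)))"
proof -
  define z where "z n = dyadic_point n (\<chi> j. \<lfloor>2 ^ n * x $ j\<rfloor>)" for n
  have z_in: "z n \<in> unit_cube" and z_lim: "z \<longlonglongrightarrow> x" for n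
    using dyadic_approximation[OF x] unfolding z_def by auto
  have f_lim: "(\<lambda>n. f (w n)) \<longlonglongrightarrow> f y" if "\<And>n. w n \<in> unit_cube" "w \<longlonglongrightarrow> y" "y \<in> unit_cube" for w y
    using continuous_on_tendsto_compose[OF cont that(2,3)] that(1) by simp
  \<comment> \<open>Continuity is known on the cube only, so the points with a replaced coordinate
    must stay inside; a < r < 2^r ensures this.\<close>
  have upd_in: "vec_upd y i (real a / 2 ^ r) \<in> unit_cube" if "y \<in> unit_cube" "a < r" for y :: "real ^ 'd" and a
  proof -
    have "a \<le> 2 ^ r"
      using that(2) less_exp[of r] by linarith
    then have "real a \<le> 2 ^ r"
      by simp
    then show ?thesis
      using that by (auto simp: unit_cube_def vec_upd_def)
  qed
  have upd_lim: "(\<lambda>n. vec_upd (z n) i y) \<longlonglongrightarrow> vec_upd x i y" for y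
    by (rule vec_tendstoI) (simp add: vec_upd_def tendsto_vec_nth z_lim)
  have "(\<lambda>n. \<Sum>a<r. poly (lagrange_basis r (\<lambda>b. real b / 2 ^ r) a) (z n $ i) * f (vec_upd (z n) i (real a / 2 ^ r)))
    \<longlonglongrightarrow> (\<Sum>a<r. poly (lagrange_basis r (\<lambda>b. real b / 2 ^ r) a) (x $ i) * f (vec_upd x i (real a / 2 ^ r)))"
    by (intro tendsto_sum tendsto_mult tendsto_poly f_lim tendsto_vec_nth upd_lim upd_in z_in z_lim x) auto
  \<comment> \<open>The identity is available from level r on, which suffices for the limit.\<close>
  moreover have "\<forall>\<^sub>F n in sequentially. (\<Sum>a<r. poly (lagrange_basis r (\<lambda>b. real b / 2 ^ r) a) (z n $ i)
      * f (vec_upd (z n) i (real a / 2 ^ r))) = f (z n)"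
    using eventually_ge_at_top[of r]
  proof eventually_elim
    case (elim n)
    show ?case
      using interpolate_dyadic[OF cont \<open>r \<ge> 1\<close> Psi elim z_in[of n, unfolded z_def]]
      unfolding z_def by (rule sym)
  qed
  ultimately have "(\<lambda>n. f (z n)) \<longlonglongrightarrow> (\<Sum>a<r. poly (lagrange_basis r (\<lambda>b. real b / 2 ^ r) a) (x $ i)
      * f (vec_upd x i (real a / 2 ^ r)))"
    by (rule Lim_transform_eventually)
  moreover have "(\<lambda>n. f (z n)) \<longlonglongrightarrow> f x"
    by (intro f_lim z_in z_lim x)
  ultimately show ?thesis
    using LIMSEQ_unique by blast
qed

text \<open>Induction on the set S of coordinates already moved to nodes. A further coordinate i is
  still that of x, so \<open>step\<close> applies to each term and contributes a factor evaluated at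
  x.\<close>

lemma interpolate_coordinates:
  fixes f :: "real ^ 'd \<Rightarrow> real" and L :: "nat \<Rightarrow> real poly" and t :: "nat \<Rightarrow> real"
  assumes t: "\<And>a. a < r \<Longrightarrow> 0 \<le> t a \<and> t a \<le> 1"
    and step: "\<And>x i. x \<in> unit_cube \<Longrightarrow> f x = (\<Sum>a<r. poly (L a) (x $ i) * f (vec_upd x i (t a)))"
    and x: "x \<in> unit_cube" and "finite S"
  shows "f x = (\<Sum>\<alpha>\<in>S \<rightarrow>\<^sub>E {..<r}. (\<Prod>j\<in>S. poly (L (\<alpha> j)) (x $ j))
    * f (\<chi> j. if j \<in> S then t (\<alpha> j) else x $ j))"
  using \<open>finite S\<close>
proof (induction S)
  case (insert i S)
  let ?z = "\<lambda>S \<alpha>. \<chi> j. if j \<in> S then t (\<alpha> j) else x $ j"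
  have upd: "vec_upd (?z S \<alpha>) i (t a) = ?z (insert i S) (\<alpha>(i := a))" for \<alpha> a
    using insert.hyps by (auto simp: vec_upd_def vec_eq_iff)
  have in_cube: "?z S \<alpha> \<in> unit_cube" if "\<alpha> \<in> S \<rightarrow>\<^sub>E {..<r}" for \<alpha>
    using that x t by (auto simp: unit_cube_def PiE_iff)
  have prod: "(\<Prod>j\<in>insert i S. poly (L ((\<alpha>(i := a)) j)) (x $ j))
      = poly (L a) (x $ i) * (\<Prod>j\<in>S. poly (L (\<alpha> j)) (x $ j))" for \<alpha> a
  proof -
    have "(\<Prod>j\<in>S. poly (L ((\<alpha>(i := a)) j)) (x $ j)) = (\<Prod>j\<in>S. poly (L (\<alpha> j)) (x $ j))"
      using insert.hyps by (intro prod.cong) auto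
    then show ?thesis
      using insert.hyps by simp
  qed
  have "f x = (\<Sum>\<alpha>\<in>S \<rightarrow>\<^sub>E {..<r}. (\<Prod>j\<in>S. poly (L (\<alpha> j)) (x $ j)) * f (?z S \<alpha>))"
    by (rule insert.IH)
  also have "\<dots> = (\<Sum>\<alpha>\<in>S \<rightarrow>\<^sub>E {..<r}. \<Sum>a<r. (\<Prod>j\<in>insert i S. poly (L ((\<alpha>(i := a)) j)) (x $ j))
      * f (?z (insert i S) (\<alpha>(i := a))))"
  proof (intro sum.cong refl)
    fix \<alpha> assume "\<alpha> \<in> S \<rightarrow>\<^sub>E {..<r}"
    from step[OF in_cube[OF this], of i]
    have "f (?z S \<alpha>) = (\<Sum>a<r. poly (L a) (x $ i) * f (?z (insert i S) (\<alpha>(i := a))))"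
      using insert.hyps unfolding upd by simp
    then show "(\<Prod>j\<in>S. poly (L (\<alpha> j)) (x $ j)) * f (?z S \<alpha>) =
        (\<Sum>a<r. (\<Prod>j\<in>insert i S. poly (L ((\<alpha>(i := a)) j)) (x $ j)) * f (?z (insert i S) (\<alpha>(i := a))))"
      unfolding prod by (simp only: sum_distrib_left mult_ac)
  qed
  also have "\<dots> = (\<Sum>(a, \<alpha>)\<in>{..<r} \<times> (S \<rightarrow>\<^sub>E {..<r}). (\<Prod>j\<in>insert i S. poly (L ((\<alpha>(i := a)) j)) (x $ j))
      * f (?z (insert i S) (\<alpha>(i := a))))"
    by (subst sum.swap) (rule sum.cartesian_product)
  \<comment> \<open>Since i is not in S, the map (a, \<alpha>) to \<open>\<alpha>(i := a)\<close> is
    a bijection onto the choices for \<open>insert i S\<close>; working with extensional functions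
    makes it injective.\<close>
  also have "\<dots> = (\<Sum>\<alpha>\<in>insert i S \<rightarrow>\<^sub>E {..<r}. (\<Prod>j\<in>insert i S. poly (L (\<alpha> j)) (x $ j))
      * f (?z (insert i S) \<alpha>))"
    unfolding PiE_insert_eq
    by (subst sum.reindex[OF inj_combinator[OF insert.hyps(2)]]) (simp add: case_prod_unfold)
  finally show ?case .
qed simp

text \<open>The degree bound lets all factors be written as sums over the same range k < r;
  distributing the product over these sums gives one monomial for each choice of exponents.\<close>

lemma prod_poly_expand:
  fixes x :: "real ^ 'd"
  assumes "\<And>j. degree (P j) < r"
  shows "(\<Prod>j\<in>UNIV. poly (P j) (x $ j))
    = (\<Sum>\<beta> | \<forall>j. \<beta> j < r. (\<Prod>j\<in>UNIV. coeff (P j) (\<beta> j)) * (\<Prod>j\<in>UNIV. (x $ j) ^ \<beta> j))"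
proof -
  have "poly (P j) y = (\<Sum>k<r. coeff (P j) k * y ^ k)" for j y
    unfolding poly_altdef using assms[of j]
    by (intro sum.mono_neutral_left) (auto simp: coeff_eq_0)
  moreover have "(UNIV :: 'd set) \<rightarrow>\<^sub>E {..<r} = {\<beta>. \<forall>j. \<beta> j < r}"
    by auto
  ultimately show ?thesis
    by (simp add: prod_sum_PiE prod.distrib)
qed

theorem theorem5p1:
  fixes f :: "real ^ 'd \<Rightarrow> real" and r :: nat
  assumes "r \<ge> 1"
    and "continuous_on unit_cube f"
    and "(\<lambda>n. Psi r f n) \<in> o(\<lambda>n. 1 / 2 ^ (n * r))"
  shows "(\<forall>n. Psi r f n = 0) \<and> (\<exists>p \<in> coord_polys r. \<forall>x \<in> unit_cube. f x = p x)"
proof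
  show Psi: "\<forall>n. Psi r f n = 0"
    using Psi_eq_0[OF assms(2,3)] by blast
  define t :: "nat \<Rightarrow> real" where "t a = real a / 2 ^ r" for a
  define L where "L = lagrange_basis r t"
  let ?A = "{\<alpha> :: 'd \<Rightarrow> nat. \<forall>j. \<alpha> j < r}"
  have A: "(UNIV :: 'd set) \<rightarrow>\<^sub>E {..<r} = ?A"
    by auto
  \<comment> \<open>The coefficient of the monomial with exponents \<beta> after expanding the
    tensor product Lagrange interpolant of f, whose nodes are the points with coordinates t
    (\<alpha> j).\<close>
  define c where "c \<beta> = (\<Sum>\<alpha>\<in>?A. (\<Prod>j\<in>UNIV. coeff (L (\<alpha> j)) (\<beta> j)) * f (\<chi> j. t (\<alpha> j)))" for \<beta> :: "'d \<Rightarrow> nat"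
  define p where "p x = (\<Sum>\<beta>\<in>?A. c \<beta> * (\<Prod>j\<in>UNIV. (x $ j) ^ \<beta> j))" for x :: "real ^ 'd"
  have "f x = p x" if x: "x \<in> unit_cube" for x
  proof -
    have t_in: "0 \<le> t a \<and> t a \<le> 1" if "a < r" for a
    proof -
      have "a \<le> 2 ^ r"
        using that less_exp[of r] by linarith
      then show ?thesis
        by (simp add: t_def)
    qed
    have "f y = (\<Sum>a<r. poly (L a) (y $ i) * f (vec_upd y i (t a)))" if "y \<in> unit_cube" for y i
      using interpolate_coordinate[OF assms(2,1) spec[OF Psi] that] unfolding L_def t_def .
    \<comment> \<open>With all coordinates moved to nodes, f enters only through its values at
      finitely many fixed points, and x only through the basis polynomials.\<close>
    from interpolate_coordinates[OF t_in this x, of UNIV]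
    have "f x = (\<Sum>\<alpha>\<in>?A. (\<Prod>j\<in>UNIV. poly (L (\<alpha> j)) (x $ j)) * f (\<chi> j. t (\<alpha> j)))"
      unfolding A by simp
    also have "\<dots> = (\<Sum>\<alpha>\<in>?A. (\<Sum>\<beta>\<in>?A. (\<Prod>j\<in>UNIV. coeff (L (\<alpha> j)) (\<beta> j)) * (\<Prod>j\<in>UNIV. (x $ j) ^ \<beta> j))
        * f (\<chi> j. t (\<alpha> j)))"
      by (intro sum.cong refl arg_cong2[where f = "(*)"] prod_poly_expand)
        (auto simp: L_def intro: degree_lagrange_basis)
    also have "\<dots> = p x"
      unfolding p_def c_def sum_distrib_right by (subst sum.swap) (simp only: mult_ac)
    finally show ?thesis .
  qed
  moreover have "p \<in> coord_polys r"
    unfolding coord_polys_def p_def by blast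
  ultimately show "\<exists>p \<in> coord_polys r. \<forall>x \<in> unit_cube. f x = p x"
    by blast
qed

end
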